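(* Let $\Omega=\{1,2,\ldots,n\}$, let $G$ be a subgroup of $S_n$ and let $(A^\pi)_{\pi\in S_n}$ be a probability distribution on $S_n$ that is constant on the right cosets $G\cdot\pi$, i.e. $A^\pi=A^{g\pi}$ for all $g\in G$ and $\pi\in S_n$. Then $\sum_{\pi\in S_n}A^\pi\, m_\pi$ is a $G$-symmetric quasi-value, where $m_\pi$ denotes the marginal operator of $\pi$.
   Context: Let $\Omega=\{1,\ldots,n\}$ be the set of players. A cooperative game is a function $v:2^\Omega\to\mathbb{R}$ with $v(\emptyset)=0$; it is additive if $v(R\cup T)=v(R)+v(T)$ whenever $R\cap T=\emptyset$. Let $\Gamma$ be the real vector space of all cooperative games and $\Gamma_1$ the subspace of additive ones. A game value is a map $\varphi:\Gamma\to\Gamma_1$; put $\varphi_i(v):=\varphi(v)(\{i\})$ for $i\in\Omega$; the additive game $\varphi(v)$ is determined by the numbers $\varphi_i(v)$. A permutation $\pi$ of $\Omega$ acts on games by $(\pi\cdot v)(R)=v(\pi^{-1}(R))$. Products of permutations are compositions: $(g\pi)(i)=g(\pi(i))$. A quasi-value is a game value $\varphi$ satisfying: (1) Linearity: $\varphi(\alpha v+\beta w)=\alpha\varphi(v)+\beta\varphi(w)$ for all $v,w\in\Gamma$, $\alpha,\beta\in\mathbb{R}$; (2) Null-player property: if $v(R\cup\{i\})=v(R)$ for every $R\subseteq\Omega$, then $\varphi_i(v)=0$; (3) Efficiency: $\sum_{i\in\Omega}\varphi_i(v)=v(\Omega)$ for all $v\in\Gamma$. For a group $G$ of permutations of $\Omega$,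 a $G$-symmetric quasi-value is a quasi-value $\varphi$ such that $\varphi(\pi\cdot v)=\pi\cdot\varphi(v)$ for all $\pi\in G$ and all $v\in\Gamma$. For $\pi\in S_n$, the marginal operator $m_\pi:\Gamma\to\Gamma_1$ is the game value defined by $(m_\pi(v))_{\pi(1)}=v(\{\pi(1)\})$ and $(m_\pi(v))_{\pi(i)}=v(\{\pi(1),\ldots,\pi(i)\})-v(\{\pi(1),\ldots,\pi(i-1)\})$ for $i=2,\ldots,n$, where $(m_\pi(v))_j=m_\pi(v)(\{j\})$. *)

theory Defs
  imports Complex_Main "HOL-Algebra.Sym_Groups"
begin

abbreviation players :: "nat \<Rightarrow> nat set" where
  "players n \<equiv> {1..n}"

(* A game is only meaningful on subsets of the player set.  Fixing the value 0 on all other sets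
   makes equality of games the equality of functions, and the games a subspace of the space of
   all functions under the pointwise operations. *)
definition games :: "nat \<Rightarrow> (nat set \<Rightarrow> real) set" where
  "games n = {v. v {} = 0 \<and> (\<forall>R. \<not> R \<subseteq> players n \<longrightarrow> v R = 0)}"

definition additive_games :: "nat \<Rightarrow> (nat set \<Rightarrow> real) set" where
  "additive_games n = {v \<in> games n.
     \<forall>R T. R \<subseteq> players n \<and> T \<subseteq> players n \<and> R \<inter> T = {} \<longrightarrow> v (R \<union> T) = v R + v T}"

type_synonym game_map = "(nat set \<Rightarrow> real) \<Rightarrow> (nat set \<Rightarrow> real)"

definition game_value :: "nat \<Rightarrow> game_map \<Rightarrow> bool" where
  "game_value n \<phi> \<longleftrightarrow> (\<forall>v\<in>games n. \<phi> v \<in> additive_games n)"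

definition linear_value :: "nat \<Rightarrow> game_map \<Rightarrow> bool" where
  "linear_value n \<phi> \<longleftrightarrow>
     (\<forall>v\<in>games n. \<forall>w\<in>games n. \<forall>\<alpha> \<beta> :: real.
        \<phi> (\<lambda>R. \<alpha> * v R + \<beta> * w R) = (\<lambda>R. \<alpha> * \<phi> v R + \<beta> * \<phi> w R))"

definition null_player_property :: "nat \<Rightarrow> game_map \<Rightarrow> bool" where
  "null_player_property n \<phi> \<longleftrightarrow>
     (\<forall>v\<in>games n. \<forall>i\<in>players n.
        (\<forall>R. R \<subseteq> players n \<longrightarrow> v (R \<union> {i}) = v R) \<longrightarrow> \<phi> v {i} = 0)"

definition efficient :: "nat \<Rightarrow> game_map \<Rightarrow> bool" where
  "efficient n \<phi> \<longleftrightarrow> (\<forall>v\<in>games n. (\<Sum>i\<in>players n. \<phi> v {i}) = v (players n))"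

definition quasi_value :: "nat \<Rightarrow> game_map \<Rightarrow> bool" where
  "quasi_value n \<phi> \<longleftrightarrow>
     game_value n \<phi> \<and> linear_value n \<phi> \<and> null_player_property n \<phi> \<and> efficient n \<phi>"

definition perm_act :: "(nat \<Rightarrow> nat) \<Rightarrow> (nat set \<Rightarrow> real) \<Rightarrow> (nat set \<Rightarrow> real)" where
  "perm_act \<pi> v = (\<lambda>R. v (inv_into UNIV \<pi> ` R))"

definition symmetric_quasi_value :: "nat \<Rightarrow> (nat \<Rightarrow> nat) set \<Rightarrow> game_map \<Rightarrow> bool" where
  "symmetric_quasi_value n G \<phi> \<longleftrightarrow>
     quasi_value n \<phi> \<and> (\<forall>\<pi>\<in>G. \<forall>v\<in>games n. \<phi> (perm_act \<pi> v) = perm_act \<pi> (\<phi> v))"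

definition marginal_contribution :: "(nat \<Rightarrow> nat) \<Rightarrow> (nat set \<Rightarrow> real) \<Rightarrow> nat \<Rightarrow> real" where
  "marginal_contribution \<pi> v j =
     (let i = inv_into UNIV \<pi> j in
      if i = 1 then v {\<pi> 1} else v (\<pi> ` {1..i}) - v (\<pi> ` {1..i - 1}))"

(* The additive game whose value on each singleton {j} is the marginal contribution of j. *)
definition marginal :: "nat \<Rightarrow> (nat \<Rightarrow> nat) \<Rightarrow> game_map" where
  "marginal n \<pi> v =
     (\<lambda>R. if R \<subseteq> players n then \<Sum>j\<in>R. marginal_contribution \<pi> v j else 0)"

lemma marginal_first:
  assumes "\<pi> permutes players n" and "1 \<le> n"
  shows "marginal n \<pi> v {\<pi> 1} = v {\<pi> 1}"
  using permutes_in_image[OF assms(1), of 1] assms(2)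
  by (simp add: marginal_def marginal_contribution_def permutes_inverses[OF assms(1)])

lemma marginal_later:
  assumes "\<pi> permutes players n" and "i \<in> {2..n}"
  shows "marginal n \<pi> v {\<pi> i} = v (\<pi> ` {1..i}) - v (\<pi> ` {1..i - 1})"
  using permutes_in_image[OF assms(1), of i] assms(2)
  by (simp add: marginal_def marginal_contribution_def permutes_inverses[OF assms(1)])

lemma marginal_game_value: "game_value n (marginal n \<pi>)"
proof -
  have "(\<Sum>j\<in>R \<union> T. f j) = (\<Sum>j\<in>R. f j) + (\<Sum>j\<in>T. f j)"
    if "R \<subseteq> players n" "T \<subseteq> players n" "R \<inter> T = {}" for R T and f :: "nat \<Rightarrow> real"
    using that by (meson finite_atLeastAtMost finite_subset sum.union_disjoint)
  then show ?thesis
    by (auto simp: game_value_def additive_games_def games_def marginal_def)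
qed

end

theory Submission
  imports Defs
begin

text \<open>
  Each marginal operator is linear, kills null players and is efficient (its contributions
  telescope), and these properties pass to averages. Symmetry comes from the equivariance
  \<open>m\<^bsub>g\<pi>\<^esub>(g\<cdot>v) = g\<cdot>m\<^bsub>\<pi>\<^esub>(v)\<close>: reindexing the average by \<open>\<pi> \<mapsto> g\<pi>\<close> costs nothing because the
  weights are constant on the cosets \<open>G\<pi>\<close>.
\<close>

text \<open>The separate case \<open>i = 1\<close> of the definition disappears: there
  \<open>{1..i - 1}\<close> is empty and a game vanishes on the empty coalition. Later arguments can
  thus treat all positions alike.\<close>

lemma marginal_contribution_apply:
  assumes "\<pi> permutes players n" and "v \<in> games n" and "i \<in> players n"
  shows "marginal_contribution \<pi> v (\<pi> i) = v (\<pi> ` {1..i}) - v (\<pi> ` {1..i - 1})"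
  using assms(2)
  by (simp add: marginal_contribution_def permutes_inverses[OF assms(1)] games_def)

lemma marginal_singleton:
  assumes "j \<in> players n"
  shows "marginal n \<pi> v {j} = marginal_contribution \<pi> v j"
  using assms by (simp add: marginal_def)

lemma marginal_linear:
  "marginal n \<pi> (\<lambda>R. \<alpha> * v R + \<beta> * w R) S = \<alpha> * marginal n \<pi> v S + \<beta> * marginal n \<pi> w S"
proof -
  have "marginal_contribution \<pi> (\<lambda>R. \<alpha> * v R + \<beta> * w R) j
      = \<alpha> * marginal_contribution \<pi> v j + \<beta> * marginal_contribution \<pi> w j" for j
    by (simp add: marginal_contribution_def Let_def algebra_simps)
  then show ?thesis
    by (simp add: marginal_def sum.distrib sum_distrib_left)
qed

text \<open>If \<open>j\<close> stands at position \<open>i\<close> of the order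
  \<open>\<pi>\<close>, the two coalitions in its marginal contribution differ by \<open>j\<close>
  alone, so a null player contributes nothing.\<close>

lemma marginal_null_player:
  assumes \<pi>: "\<pi> permutes players n" and v: "v \<in> games n" and j: "j \<in> players n"
    and null: "\<And>R. R \<subseteq> players n \<Longrightarrow> v (R \<union> {j}) = v R"
  shows "marginal n \<pi> v {j} = 0"
proof -
  obtain i where i: "i \<in> players n" "j = \<pi> i"
    using j permutes_image[OF \<pi>] by blast
  then have "{1..i} = {1..i - 1} \<union> {i}"
    by auto
  then have "\<pi> ` {1..i} = \<pi> ` {1..i - 1} \<union> {j}"
    unfolding i(2) by blast
  moreover have "\<pi> ` {1..i - 1} \<subseteq> players n"
    using i(1) by (subst permutes_image[OF \<pi>, symmetric]) (rule image_mono, auto)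
  ultimately show ?thesis
    using null marginal_contribution_apply[OF \<pi> v i(1)] i(2) marginal_singleton[OF j] by simp
qed

lemma marginal_efficient:
  assumes \<pi>: "\<pi> permutes players n" and v: "v \<in> games n"
  shows "(\<Sum>j\<in>players n. marginal n \<pi> v {j}) = v (players n)"
proof -
  have "(\<Sum>j\<in>players n. marginal n \<pi> v {j}) = (\<Sum>j\<in>players n. marginal_contribution \<pi> v j)"
    by (simp add: marginal_singleton)
  \<comment> \<open>Summing over positions instead of players puts the contributions in the order in
    which they telescope.\<close>
  also have "\<dots> = (\<Sum>i\<in>players n. marginal_contribution \<pi> v (\<pi> i))"
    using sum.permute[OF \<pi>, of "marginal_contribution \<pi> v"] by (simp add: comp_def)
  also have "\<dots> = (\<Sum>i=1..n. v (\<pi> ` {1..i}) - v (\<pi> ` {1..i - 1}))"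
    by (intro sum.cong refl marginal_contribution_apply[OF \<pi> v])
  \<comment> \<open>In the telescoped sum the lower end \<open>{1..0}\<close> is the empty
    coalition, worth 0 in a game.\<close>
  also have "\<dots> = v (\<pi> ` {1..n}) - v (\<pi> ` {1..0})"
    by (induction n) (auto simp: atLeastAtMostSuc_conv)
  also have "\<dots> = v (players n)"
    using v permutes_image[OF \<pi>] by (simp add: games_def)
  finally show ?thesis .
qed

lemma marginal_equivariant:
  assumes g: "g permutes players n" and \<pi>: "\<pi> permutes players n"
  shows "marginal n (g \<circ> \<pi>) (perm_act g v) R = marginal n \<pi> v (inv_into UNIV g ` R)"
proof -
  have "bij g" "bij \<pi>"
    using g \<pi> by (auto intro: permutes_bij)
  have cancel: "perm_act g v (g ` S) = v S" for S
    using \<open>bij g\<close> by (simp add: perm_act_def image_image bij_is_inj)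
  have cancel_image: "perm_act g v ((\<lambda>x. g (\<pi> x)) ` S) = v (\<pi> ` S)" for S
    using cancel[of "\<pi> ` S"] by (simp add: image_image)
  have contribution: "marginal_contribution (g \<circ> \<pi>) (perm_act g v) (g k)
      = marginal_contribution \<pi> v k" for k
    using cancel[of "{\<pi> 1}"]
    by (simp add: marginal_contribution_def o_inv_distrib[OF \<open>bij g\<close> \<open>bij \<pi>\<close>]
        permutes_inverses[OF g] cancel_image Let_def)
  have "inj_on g (inv_into UNIV g ` R)"
    using \<open>bij g\<close> by (meson bij_is_inj inj_on_subset subset_UNIV)
  then have "(\<Sum>j\<in>g ` inv_into UNIV g ` R. marginal_contribution (g \<circ> \<pi>) (perm_act g v) j)
      = (\<Sum>k\<in>inv_into UNIV g ` R. marginal_contribution \<pi> v k)"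
    by (simp add: sum.reindex contribution)
  moreover have "g ` inv_into UNIV g ` R = R"
    using \<open>bij g\<close> by (simp add: bij_is_surj image_f_inv_f)
  \<comment> \<open>Both sides default to 0 off the player set, so they must do so for the same
    \<open>R\<close>.\<close>
  moreover have "inv_into UNIV g ` R \<subseteq> players n \<longleftrightarrow> R \<subseteq> players n"
    using permutes_in_image[OF permutes_inv[OF g]] by blast
  ultimately show ?thesis
    by (simp add: marginal_def)
qed

lemma game_value_sum:
  assumes "\<And>i. i \<in> I \<Longrightarrow> game_value n (\<phi> i)"
  shows "game_value n (\<lambda>v R. \<Sum>i\<in>I. c i * \<phi> i v R)"
  using assms
  by (auto simp: game_value_def additive_games_def games_def distrib_left sum.distrib
      intro!: sum.neutral)

lemma marginal_average_quasi_value: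
  assumes perms: "\<And>\<pi>. \<pi> \<in> P \<Longrightarrow> \<pi> permutes players n" and total: "(\<Sum>\<pi>\<in>P. A \<pi>) = 1"
  shows "quasi_value n (\<lambda>v R. \<Sum>\<pi>\<in>P. A \<pi> * marginal n \<pi> v R)"
  unfolding quasi_value_def
proof (intro conjI)
  show "game_value n (\<lambda>v R. \<Sum>\<pi>\<in>P. A \<pi> * marginal n \<pi> v R)"
    by (intro game_value_sum marginal_game_value)
  show "linear_value n (\<lambda>v R. \<Sum>\<pi>\<in>P. A \<pi> * marginal n \<pi> v R)"
    by (simp add: linear_value_def marginal_linear sum.distrib sum_distrib_left algebra_simps)
  show "null_player_property n (\<lambda>v R. \<Sum>\<pi>\<in>P. A \<pi> * marginal n \<pi> v R)"
    unfolding null_player_property_def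
    by (intro ballI impI sum.neutral) (metis marginal_null_player perms mult_zero_right)
  show "efficient n (\<lambda>v R. \<Sum>\<pi>\<in>P. A \<pi> * marginal n \<pi> v R)"
    unfolding efficient_def
  proof
    fix v assume v: "v \<in> games n"
    \<comment> \<open>Swapping the sums isolates the total payoff of each marginal operator, which
      is \<open>v (players n)\<close> regardless of \<open>\<pi>\<close>; the weights then add up to
      1.\<close>
    have "(\<Sum>i\<in>players n. \<Sum>\<pi>\<in>P. A \<pi> * marginal n \<pi> v {i})
        = (\<Sum>\<pi>\<in>P. A \<pi> * (\<Sum>i\<in>players n. marginal n \<pi> v {i}))"
      by (subst sum.swap) (simp add: sum_distrib_left)
    also have "\<dots> = (\<Sum>\<pi>\<in>P. A \<pi>) * v (players n)"
      using v by (simp add: marginal_efficient perms sum_distrib_right del: One_nat_def)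
    finally show "(\<Sum>i\<in>players n. \<Sum>\<pi>\<in>P. A \<pi> * marginal n \<pi> v {i}) = v (players n)"
      using total by simp
  qed
qed

theorem proposition1:
  fixes n :: nat
    and G :: "(nat \<Rightarrow> nat) set"
    and A :: "(nat \<Rightarrow> nat) \<Rightarrow> real"
  assumes "subgroup G (sym_group n)"
    and "\<And>\<pi>. \<pi> \<in> carrier (sym_group n) \<Longrightarrow> 0 \<le> A \<pi>"
    and "(\<Sum>\<pi>\<in>carrier (sym_group n). A \<pi>) = 1"
    and "\<And>g \<pi>. g \<in> G \<Longrightarrow> \<pi> \<in> carrier (sym_group n) \<Longrightarrow> A \<pi> = A (g \<circ> \<pi>)"
  shows "symmetric_quasi_value n G
           (\<lambda>v R. \<Sum>\<pi>\<in>carrier (sym_group n). A \<pi> * marginal n \<pi> v R)"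
proof -
  have carrier: "carrier (sym_group n) = {\<pi>. \<pi> permutes players n}"
    by (simp add: sym_group_def)
  \<comment> \<open>Symmetry is an equality of functions on sets, so it is checked at every
    \<open>R\<close>, not just at singletons.\<close>
  have "(\<Sum>\<pi>\<in>carrier (sym_group n). A \<pi> * marginal n \<pi> (perm_act g v) R)
      = perm_act g (\<lambda>R. \<Sum>\<pi>\<in>carrier (sym_group n). A \<pi> * marginal n \<pi> v R) R"
    if "g \<in> G" for g v R
  proof -
    have g: "g permutes players n"
      using subgroup.subset[OF assms(1)] \<open>g \<in> G\<close> carrier by auto
    \<comment> \<open>Left composition with \<open>g\<close> is a bijection of the symmetric group
      that maps each coset of \<open>G\<close> to itself, so the next step can restore the weight
      \<open>A \<pi>\<close> termwise.\<close>
    have "(\<Sum>\<pi>\<in>carrier (sym_group n). A \<pi> * marginal n \<pi> (perm_act g v) R)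
        = (\<Sum>\<pi>\<in>carrier (sym_group n). A (g \<circ> \<pi>) * marginal n (g \<circ> \<pi>) (perm_act g v) R)"
      unfolding carrier by (rule setum_permutations_compose_left[OF g])
    also have "\<dots> = (\<Sum>\<pi>\<in>carrier (sym_group n). A \<pi> * marginal n \<pi> v (inv_into UNIV g ` R))"
      using assms(4)[OF \<open>g \<in> G\<close>] by (intro sum.cong) (simp_all add: carrier marginal_equivariant[OF g])
    finally show ?thesis
      by (simp add: perm_act_def)
  qed
  moreover have "quasi_value n (\<lambda>v R. \<Sum>\<pi>\<in>carrier (sym_group n). A \<pi> * marginal n \<pi> v R)"
    using assms(3) by (intro marginal_average_quasi_value) (simp_all add: carrier)
  ultimately show ?thesis
    by (simp add: symmetric_quasi_value_def fun_eq_iff)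
qed

end
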